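(* Let $G$ be a finite simple graph containing an induced odd cycle $C_{2n+1}=(x_1,\ldots,x_{2n+1})$, $n\ge 1$ ($G$ may contain other cycles), and let $l=|E(G)\setminus E(C_{2n+1})|$, so $|E(G)|=2n+1+l$. For $n+1\le j\le 2n+1+l$ let $d'_j$ be the number of subsets of $E(G)$ of cardinality $j$ that contain a Type-I minimum edge cover for $C_{2n+1}$ in $G$. Then $$d'_{n+1+k}=(2n+1)\binom{n-1+l}{k}\quad\text{for } 0\le k\le n-1,$$ $$d'_{2n+1+k}=(2n+1)\binom{n-1+l}{n+k}+\binom{l}{k}\quad\text{for } 0\le k\le l-1,$$ and $d'_{2n+1+l}=1$.
   Context: Let $H$ be an induced subgraph of a finite simple graph $G$. An edge cover for $H$ in $G$ is a set $L\subseteq E(G)$ such that every vertex of $H$ is incident to some edge of $L$. It is a Type-I edge cover if $L\subseteq E(H)$. A Type-I minimum edge cover for $H$ in $G$ is a Type-I edge cover for $H$ in $G$ of smallest possible cardinality among all Type-I edge covers for $H$ in $G$. Binomial coefficients $\binom{a}{b}$ with $b>a$ are $0$. *)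

theory Defs
  imports Main
begin

record 'a graph =
  verts :: "'a set"
  edges :: "'a set set"

definition finite_simple_graph :: "'a graph \<Rightarrow> bool" where
  "finite_simple_graph G \<longleftrightarrow>
     finite (verts G) \<and> (\<forall>e \<in> edges G. e \<subseteq> verts G \<and> card e = 2)"

definition induced_subgraph :: "'a graph \<Rightarrow> 'a graph \<Rightarrow> bool" where
  "induced_subgraph H G \<longleftrightarrow>
     verts H \<subseteq> verts G \<and> edges H = {e \<in> edges G. e \<subseteq> verts H}"

(* Meant for distinct lists of length at least 3; otherwise it is not a cycle. *)
definition cycle_graph :: "'a list \<Rightarrow> 'a graph" where
  "cycle_graph xs =
     \<lparr> verts = set xs,
       edges = {{xs ! i, xs ! (Suc i mod length xs)} | i. i < length xs} \<rparr>"

definition edge_cover :: "'a graph \<Rightarrow> 'a graph \<Rightarrow> 'a set set \<Rightarrow> bool" where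
  "edge_cover H G L \<longleftrightarrow> L \<subseteq> edges G \<and> (\<forall>v \<in> verts H. \<exists>e \<in> L. v \<in> e)"

definition type1_edge_cover :: "'a graph \<Rightarrow> 'a graph \<Rightarrow> 'a set set \<Rightarrow> bool" where
  "type1_edge_cover H G L \<longleftrightarrow> edge_cover H G L \<and> L \<subseteq> edges H"

definition type1_min_edge_cover :: "'a graph \<Rightarrow> 'a graph \<Rightarrow> 'a set set \<Rightarrow> bool" where
  "type1_min_edge_cover H G L \<longleftrightarrow>
     type1_edge_cover H G L \<and> (\<forall>L'. type1_edge_cover H G L' \<longrightarrow> card L \<le> card L')"

(* The number d'_j of the paper, for the induced subgraph H of G. *)
definition num_containing_type1_min :: "'a graph \<Rightarrow> 'a graph \<Rightarrow> nat \<Rightarrow> nat" where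
  "num_containing_type1_min H G j =
     card {S. S \<subseteq> edges G \<and> card S = j \<and> (\<exists>L \<subseteq> S. type1_min_edge_cover H G L)}"

end

theory Submission
  imports Defs
begin

text \<open>
  Enumerate the edges of the cycle in steps of two, \<open>f i\<close> being the edge at position \<open>2 i\<close> modulo
  \<open>2n + 1\<close>. The two edges at a vertex are then \<open>f p\<close> and \<open>f (p + n)\<close> for some \<open>p\<close>, and the minimum
  edge covers become the cyclic intervals \<open>f i, \<dots>, f (i + n)\<close> of length \<open>n + 1\<close>. A set of edges
  that contains such an interval but not the whole cycle has exactly one maximal cyclic run of
  length at least \<open>n + 1\<close>, since two of them do not fit. Counting by the start \<open>i\<close> of that run
  forces \<open>n + 1\<close> edges in and the edge \<open>f (i - 1)\<close> out, and leaves \<open>n - 1 + l\<close> edges free.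
\<close>

section \<open>Subsets between two sets, and switching points on the integers\<close>

lemma card_subsets_between:
  assumes "finite Y" "A \<subseteq> Y"
  shows "card {S. A \<subseteq> S \<and> S \<subseteq> Y \<and> card S = card A + m} = (card Y - card A) choose m"
proof -
  have fA: "finite A" using assms finite_subset by blast
  have "bij_betw (\<lambda>S. S \<union> A) {B. B \<subseteq> Y - A \<and> card B = m}
          {S. A \<subseteq> S \<and> S \<subseteq> Y \<and> card S = card A + m}"
  proof (rule bij_betw_byWitness[where f' = "\<lambda>S. S - A"])
    show "(\<lambda>S. S \<union> A) ` {B. B \<subseteq> Y - A \<and> card B = m}
            \<subseteq> {S. A \<subseteq> S \<and> S \<subseteq> Y \<and> card S = card A + m}"
    proof clarify
      fix B assume B: "B \<subseteq> Y - A" and m: "m = card B"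
      have "card (B \<union> A) = card B + card A"
        using B fA assms by (intro card_Un_disjoint) (auto intro: finite_subset)
      then show "A \<subseteq> B \<union> A \<and> B \<union> A \<subseteq> Y \<and> card (B \<union> A) = card A + card B"
        using B assms by auto
    qed
    show "(\<lambda>S. S - A) ` {S. A \<subseteq> S \<and> S \<subseteq> Y \<and> card S = card A + m}
            \<subseteq> {B. B \<subseteq> Y - A \<and> card B = m}"
      using fA by (auto simp: card_Diff_subset)
  qed auto
  then have "card {S. A \<subseteq> S \<and> S \<subseteq> Y \<and> card S = card A + m}
      = card {B. B \<subseteq> Y - A \<and> card B = m}"
    by (simp add: bij_betw_same_card)
  also have "\<dots> = card (Y - A) choose m"
    using assms by (simp add: n_subsets)
  finally show ?thesis using assms fA by (simp add: card_Diff_subset)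
qed

text \<open>Walking back from \<open>a\<close>, the point just after the first failure of
  \<open>P\<close> serves as \<open>c\<close>; it starts the run that contains
  \<open>a\<close>.\<close>

lemma ex_switch_backwards:
  fixes P :: "int \<Rightarrow> bool"
  assumes "P a" "\<not> P b" "b \<le> a"
  obtains c where "b < c" "c \<le> a" "\<not> P (c - 1)" "\<And>x. c \<le> x \<Longrightarrow> x \<le> a \<Longrightarrow> P x"
proof -
  let ?d = "LEAST d::nat. \<not> P (a - int d)"
  have ex: "\<not> P (a - int (nat (a - b)))" using assms by simp
  have d: "\<not> P (a - int ?d)" using ex by (rule LeastI)
  have le: "?d \<le> nat (a - b)" using ex by (rule Least_le)
  have below: "P (a - int k)" if "k < ?d" for k
    using not_less_Least[OF that] by simp
  have pos: "?d > 0" using d assms(1) by (metis diff_zero gr0I of_nat_0)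
  show thesis
  proof (rule that[of "a - int ?d + 1"])
    fix x assume "a - int ?d + 1 \<le> x" "x \<le> a"
    then show "P x" using below[of "nat (a - x)"] by simp
  qed (use d le pos assms in auto)
qed

section \<open>Cyclic sequences of odd length and their gap-free sets\<close>

locale odd_cyclic_enumeration =
  fixes f :: "int \<Rightarrow> 'b" and n :: nat
  assumes n_pos: "n \<ge> 1"
    and f_eq_iff: "f i = f j \<longleftrightarrow> (2 * int n + 1) dvd (i - j)"
begin

lemma f_neq: "f i \<noteq> f j" if "i < j" "j < i + 2 * int n + 1"
proof -
  have "\<not> (2 * int n + 1) dvd (j - i)" using that by (intro zdvd_not_zless) auto
  then have "f j \<noteq> f i" by (simp only: f_eq_iff not_False_eq_True)
  then show ?thesis by (rule not_sym)
qed

lemma f_shift_eq_iff: "f (i + k) = f (j + k) \<longleftrightarrow> f i = f j"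
  by (simp add: f_eq_iff)

lemma f_add_period: "f (i + (2 * int n + 1)) = f i"
  by (simp add: f_eq_iff)

lemma inj_on_window: "b \<le> a + 2 * int n \<Longrightarrow> inj_on f {a..b}"
proof (rule linorder_inj_onI)
  show "f x \<noteq> f y" if "b \<le> a + 2 * int n" "x < y" "x \<in> {a..b}" "y \<in> {a..b}" for x y
    using that by (intro f_neq) auto
qed auto

lemma window_representative:
  obtains j where "a \<le> j" "j \<le> a + 2 * int n" "f j = f i"
proof
  let ?j = "a + (i - a) mod (2 * int n + 1)"
  show "a \<le> ?j" by simp
  show "?j \<le> a + 2 * int n"
    using pos_mod_bound[of "2 * int n + 1" "i - a"] by linarith
  show "f ?j = f i"
    unfolding f_eq_iff
    by (metis add_diff_eq diff_add_eq_diff_diff_swap diff_diff_eq2 dvd_minus_mod dvd_minus_iff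
        minus_diff_eq add.commute)
qed

lemma image_window: "f ` {a..a + 2 * int n} = range f"
proof
  show "range f \<subseteq> f ` {a..a + 2 * int n}"
  proof
    fix y assume "y \<in> range f"
    then obtain i where "y = f i" by blast
    then show "y \<in> f ` {a..a + 2 * int n}"
      by (metis window_representative atLeastAtMost_iff image_eqI)
  qed
qed blast

lemma card_interval: "b \<le> a + 2 * int n \<Longrightarrow> card (f ` {a..b}) = nat (b - a + 1)"
  by (simp add: card_image inj_on_window)

lemma finite_range: "finite (range f)"
  using image_window[of 0] by (metis finite_atLeastAtMost_int finite_imageI)

lemma card_range: "card (range f) = 2 * n + 1"
  using card_interval[of "2 * int n" 0] image_window[of 0] by simp

text \<open>Periodicity replaces \<open>b\<close> by an index in the window of one period that ends
  at \<open>a\<close>, so \<open>a\<close> and \<open>b\<close> may come in any order.\<close>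

lemma ex_switch:
  assumes "P (f a)" "\<not> P (f b)"
  obtains c where "c \<le> a" "\<not> P (f (c - 1))" "\<And>x. c \<le> x \<Longrightarrow> x \<le> a \<Longrightarrow> P (f x)"
proof -
  obtain j where "j \<le> a" "f j = f b"
    using window_representative[of "a - 2 * int n" b] by force
  then show thesis
    using ex_switch_backwards[of "\<lambda>x. P (f x)" a j] assms that by metis
qed

text \<open>The two edges at a vertex of the cycle will be some \<open>f p\<close> and
  \<open>f (p + int n)\<close>, so these sets are the Type-I edge covers.\<close>

definition gap_free :: "'b set \<Rightarrow> bool" where
  "gap_free L \<longleftrightarrow> L \<subseteq> range f \<and> (\<forall>p. f p \<in> L \<or> f (p + int n) \<in> L)"

text \<open>The element \<open>f p\<close> lies in the pair at \<open>p\<close> and in the pair at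
  \<open>p + n + 1\<close>, as \<open>(p + n + 1) + n\<close> is \<open>p\<close> up to a
  period.\<close>

lemma gap_free_shift:
  assumes "gap_free L" "f p \<notin> L"
  shows "f (p + int n) \<in> L" "f (p + (int n + 1)) \<in> L"
proof -
  show "f (p + int n) \<in> L" using assms by (auto simp: gap_free_def)
  have "f (p + (int n + 1) + int n) = f p"
    using f_add_period[of p] by (simp add: algebra_simps)
  then show "f (p + (int n + 1)) \<in> L" using assms by (metis gap_free_def)
qed

text \<open>Shifting indices preserves distinctness. Shifted copies of the complement are later
  fitted into \<open>L\<close>.\<close>

lemma card_shifted_complement:
  "card ((\<lambda>x. f (x + k)) ` {x \<in> {0..2 * int n}. f x \<notin> L}) = card (range f - L)"
proof -
  let ?W = "{x \<in> {0..2 * int n}. f x \<notin> L}"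
  have inj: "inj_on f ?W"
    using inj_on_window[of "2 * int n" 0] by (auto intro: inj_on_subset)
  then have inj_shift: "inj_on (\<lambda>x. f (x + k)) ?W"
    by (simp add: inj_on_def f_shift_eq_iff)
  have "f ` ?W = f ` {0..2 * int n} - L" by blast
  also have "f ` {0..2 * int n} = range f" using image_window[of 0] by simp
  finally have "card (range f - L) = card ?W" using card_image[OF inj] by metis
  then show ?thesis using card_image[OF inj_shift] by metis
qed

lemma card_complement: "L \<subseteq> range f \<Longrightarrow> card (range f - L) + card L = 2 * n + 1"
  using finite_range card_range
  by (metis card_Diff_subset card_mono finite_subset le_add_diff_inverse2)

text \<open>The complement shifted by \<open>n\<close> lies in \<open>L\<close>, so it is no larger
  than \<open>L\<close>, and both sizes add up to the odd number \<open>2n + 1\<close>.\<close>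

lemma card_gap_free_ge:
  assumes "gap_free L"
  shows "n + 1 \<le> card L"
proof -
  have sub: "L \<subseteq> range f" using assms by (simp add: gap_free_def)
  have "card (range f - L) \<le> card L"
    unfolding card_shifted_complement[of "int n", symmetric]
    using gap_free_shift(1)[OF assms] sub finite_range
    by (intro card_mono) (auto intro: finite_subset)
  then show ?thesis using card_complement[OF sub] by linarith
qed

lemma gap_free_interval: "gap_free (f ` {i..i + int n})"
  unfolding gap_free_def
proof (intro conjI allI)
  fix p
  obtain j where j: "i \<le> j" "j \<le> i + 2 * int n" "f j = f p"
    by (rule window_representative)
  show "f p \<in> f ` {i..i + int n} \<or> f (p + int n) \<in> f ` {i..i + int n}"
  proof (cases "j \<le> i + int n")
    case True
    then show ?thesis using j by (metis atLeastAtMost_iff image_eqI)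
  next
    case False
    \<comment> \<open>Up to a period, \<open>j + n\<close> is \<open>j - n - 1\<close>, which lies
      between \<open>i\<close> and \<open>i + n - 1\<close>.\<close>
    have "f (p + int n) = f (j - int n - 1)"
      using j(3) f_add_period[of "j - int n - 1"] f_shift_eq_iff[of j "int n" p]
      by (simp add: algebra_simps)
    then show ?thesis using False j by auto
  qed
qed auto

text \<open>
  The complement of \<open>L\<close>, shifted by \<open>n + 1\<close>, fills all but one element of \<open>L\<close>. Every start of a run
  of the complement, shifted by \<open>n\<close>, is an element that is left, so the complement is a single run.
\<close>

lemma gap_free_min_contains_interval:
  assumes "gap_free L" "card L = n + 1"
  obtains i where "f ` {i..i + int n} \<subseteq> L"
proof -
  have sub: "L \<subseteq> range f" using assms by (simp add: gap_free_def)
  have finL: "finite L" using sub finite_range finite_subset by blast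
  have cc: "card (range f - L) = n" using card_complement[OF sub] assms(2) by simp
  obtain a where a: "f a \<notin> L"
    using cc n_pos by (metis Diff_eq_empty_iff card.empty image_subsetI not_one_le_zero)
  then obtain b where b: "f b \<in> L" using gap_free_shift(1)[OF assms(1)] by blast
  \<comment> \<open>\<open>x\<close> starts the run of missing elements that contains
    \<open>a\<close>.\<close>
  obtain x where x: "f (x - 1) \<in> L" "x \<le> a" "\<And>y. x \<le> y \<Longrightarrow> y \<le> a \<Longrightarrow> f y \<notin> L"
    using ex_switch[of "\<lambda>y. y \<notin> L" a b] a b by blast
  have fx: "f x \<notin> L" using x by blast
  let ?B = "(\<lambda>x. f (x + (int n + 1))) ` {x \<in> {0..2 * int n}. f x \<notin> L}"
  have "?B \<subseteq> L" using gap_free_shift(2)[OF assms(1)] by blast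
  then have "card (L - ?B) = 1"
    using assms(2) finL cc card_shifted_complement[of "int n + 1" L]
    by (simp add: card_Diff_subset finite_subset)
  then obtain z where z: "L - ?B = {z}" by (auto simp: card_1_singleton_iff)
  \<comment> \<open>If \<open>f (y + n)\<close> were a missing \<open>f w\<close> shifted by
    \<open>n + 1\<close>, then \<open>f (y - 1) = f w\<close> would be missing too.\<close>
  have start: "f (y + int n) = z" if "f y \<notin> L" "f (y - 1) \<in> L" for y
  proof -
    have "f (y + int n) \<notin> ?B"
    proof
      assume "f (y + int n) \<in> ?B"
      then obtain w where w: "f w \<notin> L" "f (y + int n) = f (w + (int n + 1))" by blast
      then have "f (y - 1) = f w"
        using f_shift_eq_iff[of "y - 1" "int n + 1" w] by simp
      then show False using w that by simp
    qed
    then show ?thesis using z gap_free_shift(1)[OF assms(1) that(1)] by blast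
  qed
  \<comment> \<open>Runs of missing elements start only at \<open>f x\<close>. A missing
    \<open>f (x + d)\<close> would thus make all \<open>d + 1 > n\<close> elements from
    \<open>x\<close> to \<open>x + d\<close> missing, but only \<open>n\<close> are.\<close>
  have run: "f (x + d) \<in> L" if d: "int n \<le> d" "d \<le> 2 * int n" for d
  proof (rule ccontr)
    assume nd: "f (x + d) \<notin> L"
    have "f y \<notin> L" if y: "x \<le> y" "y \<le> x + d" for y
    proof (rule ccontr)
      assume "\<not> f y \<notin> L"
      \<comment> \<open>\<open>c\<close> starts the run of missing elements that ends at
        \<open>x + d\<close>; it exceeds \<open>x\<close> by less than a period.\<close>
      then obtain c where c: "y < c" "c \<le> x + d" "f (c - 1) \<in> L"
          "\<And>w. c \<le> w \<Longrightarrow> w \<le> x + d \<Longrightarrow> f w \<notin> L"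
        using ex_switch_backwards[of "\<lambda>w. f w \<notin> L" "x + d" y] nd y by metis
      then have "f c \<notin> L" by blast
      then have "f (c + int n) = f (x + int n)"
        using start c x fx by metis
      then have "f c = f x" by (simp add: f_shift_eq_iff)
      then show False using f_neq[of x c] c d y by simp
    qed
    then have "f ` {x..x + d} \<subseteq> range f - L" by auto
    then have "card (f ` {x..x + d}) \<le> n"
      using cc finite_range by (metis card_mono finite_Diff)
    then show False using d by (simp add: card_interval)
  qed
  have "f y \<in> L" if "y \<in> {x + int n..x + int n + int n}" for y
  proof -
    have "f (x + (y - x)) \<in> L" by (rule run) (use that in auto)
    then show ?thesis by simp
  qed
  then show thesis by (intro that[of "x + int n"]) blast
qed

section \<open>Counting the sets that contain an interval\<close>

text \<open>For \<open>i < j\<close>, either \<open>j - 1\<close> lies in the first interval, or the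
  second interval reaches \<open>i + 2n\<close>, which is \<open>i - 1\<close> up to a period. Both
  contradict the gaps.\<close>

lemma run_start_unique:
  assumes "f ` {i..i + int n} \<subseteq> S" "f (i - 1) \<notin> S"
    and "f ` {j..j + int n} \<subseteq> S" "f (j - 1) \<notin> S"
    and "i \<le> j" "j \<le> i + 2 * int n"
  shows "i = j"
proof (rule ccontr)
  assume "i \<noteq> j"
  show False
  proof (cases "j \<le> i + int n + 1")
    case True
    then have "f (j - 1) \<in> f ` {i..i + int n}" using assms(5) \<open>i \<noteq> j\<close> by auto
    then show False using assms by blast
  next
    case False
    then have "f (i - 1 + (2 * int n + 1)) \<in> f ` {j..j + int n}" using assms(6) by auto
    then show False using assms unfolding f_add_period by blast
  qed
qed

text \<open>Sets that miss part of the range are sorted by the start of their unique run; sets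
  containing the whole range give the second summand. The \<open>if\<close> matters: for
  \<open>m < n\<close>, truncated subtraction would make \<open>l choose (m - n)\<close> equal to 1
  instead of 0.\<close>

lemma card_sets_containing_interval:
  assumes "finite X" "range f \<subseteq> X" "l = card (X - range f)"
  shows "card {S. S \<subseteq> X \<and> card S = n + 1 + m \<and> (\<exists>i. f ` {i..i + int n} \<subseteq> S)}
    = (2 * n + 1) * ((n - 1 + l) choose m) + (if n \<le> m then l choose (m - n) else 0)"
proof -
  have cX: "card X = 2 * n + 1 + l"
    using assms card_range finite_range
    by (metis card_Diff_subset card_mono le_add_diff_inverse)
  define F where "F i = {S. f ` {i..i + int n} \<subseteq> S \<and> S \<subseteq> X - {f (i - 1)}
    \<and> card S = card (f ` {i..i + int n}) + m}" for i
  define F0 where "F0 = {S. range f \<subseteq> S \<and> S \<subseteq> X \<and> card S = n + 1 + m}"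
  have cA: "card (f ` {i..i + int n}) = n + 1" for i
    by (simp add: card_interval nat_add_distrib)
  have cF: "card (F i) = (n - 1 + l) choose m" for i
  proof -
    \<comment> \<open>The indices from \<open>i - 1\<close> to \<open>i + n\<close> fit into one
      period because \<open>n\<close> is at least 1.\<close>
    have "f (i - 1) \<noteq> f x" if "i \<le> x" "x \<le> i + int n" for x
      using f_neq[of "i - 1" x] that n_pos by simp
    then have "f ` {i..i + int n} \<subseteq> X - {f (i - 1)}" using assms(2) by fastforce
    moreover have "card (X - {f (i - 1)}) = 2 * n + l"
      using assms(1,2) cX by (simp add: subset_iff)
    moreover have "2 * n + l - (n + 1) = n - 1 + l" using n_pos by simp
    ultimately show ?thesis
      unfolding F_def using assms(1) by (subst card_subsets_between) (simp_all only: cA finite_Diff)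
  qed
  have cF0: "card F0 = (if n \<le> m then l choose (m - n) else 0)"
  proof (cases "n \<le> m")
    case True
    then have "n + 1 + m = card (range f) + (m - n)" by (simp add: card_range)
    then show ?thesis
      using card_subsets_between[OF assms(1,2), of "m - n"] True cX card_range
      by (simp add: F0_def)
  next
    case False
    have "\<not> (range f \<subseteq> S \<and> S \<subseteq> X \<and> card S = n + 1 + m)" for S
      using False card_mono[of S "range f"] assms(1) finite_subset[of S X]
      by (auto simp: card_range)
    then have "F0 = {}" unfolding F0_def by blast
    then show ?thesis using False by simp
  qed
  have "{S. S \<subseteq> X \<and> card S = n + 1 + m \<and> (\<exists>i. f ` {i..i + int n} \<subseteq> S)}
      = (\<Union>i\<in>{0..2 * int n}. F i) \<union> F0" (is "?A = ?B")
  proof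
    show "?B \<subseteq> ?A" by (auto simp: F_def F0_def cA)
    show "?A \<subseteq> ?B"
    proof
      fix S assume "S \<in> ?A"
      then obtain i where S: "S \<subseteq> X" "card S = n + 1 + m" and i: "f ` {i..i + int n} \<subseteq> S"
        by blast
      show "S \<in> ?B"
      proof (cases "range f \<subseteq> S")
        case True
        then show ?thesis using S by (simp add: F0_def)
      next
        case False
        then obtain b where "f b \<notin> S" by blast
        moreover have "f i \<in> S" using i by auto
        \<comment> \<open>From the start \<open>c\<close> of the run through \<open>i\<close>,
          everything up to \<open>i + n\<close> is in \<open>S\<close>, hence also the
          \<open>n + 1\<close> elements from \<open>c\<close> on.\<close>
        ultimately obtain c where c: "c \<le> i" "f (c - 1) \<notin> S"
            "\<And>x. c \<le> x \<Longrightarrow> x \<le> i \<Longrightarrow> f x \<in> S"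
          using ex_switch[of "\<lambda>y. y \<in> S" i b] by blast
        \<comment> \<open>The start is moved into one fixed period, where the families
          \<open>F j\<close> are indexed.\<close>
        obtain j where j: "0 \<le> j" "j \<le> 2 * int n" "f j = f c"
          using window_representative[of 0 c] by auto
        have shift: "f (j + k) = f (c + k)" for k using j by (simp add: f_shift_eq_iff)
        have "f x \<in> S" if "j \<le> x" "x \<le> j + int n" for x
        proof -
          have "f (c + (x - j)) \<in> S"
          proof (cases "c + (x - j) \<le> i")
            case True
            then show ?thesis using c(3) that by simp
          next
            case False
            then show ?thesis using i c(1) that by auto
          qed
          then show ?thesis using shift[of "x - j"] by simp
        qed
        moreover have "f (j - 1) \<notin> S" using shift[of "-1"] c(2) by simp
        ultimately have "S \<in> F j" using S by (auto simp: F_def cA)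
        then show ?thesis using j by auto
      qed
    qed
  qed
  moreover have "card ((\<Union>i\<in>{0..2 * int n}. F i) \<union> F0)
      = card (\<Union>i\<in>{0..2 * int n}. F i) + card F0"
  proof (rule card_Un_disjoint)
    have "(\<Union>i\<in>{0..2 * int n}. F i) \<subseteq> Pow X" "F0 \<subseteq> Pow X"
      by (auto simp: F_def F0_def)
    then show "finite (\<Union>i\<in>{0..2 * int n}. F i)" "finite F0"
      using assms(1) by (meson finite_Pow_iff finite_subset)+
    show "(\<Union>i\<in>{0..2 * int n}. F i) \<inter> F0 = {}" unfolding F_def F0_def by blast
  qed
  moreover have "card (\<Union>i\<in>{0..2 * int n}. F i) = (\<Sum>i\<in>{0..2 * int n}. card (F i))"
  proof (rule card_UN_disjoint)
    show "\<forall>i\<in>{0..2 * int n}. finite (F i)"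
      using assms(1) by (auto simp: F_def intro: finite_subset[of _ "Pow X"])
    have "i = j" if "i \<le> j" "0 \<le> i" "j \<le> 2 * int n" "S \<in> F i" "S \<in> F j" for i j S
      using that by (intro run_start_unique[of i S j]) (auto simp: F_def)
    then show "\<forall>i\<in>{0..2 * int n}. \<forall>j\<in>{0..2 * int n}. i \<noteq> j \<longrightarrow> F i \<inter> F j = {}"
      by (metis (no_types, lifting) atLeastAtMost_iff disjoint_iff linorder_le_cases)
  qed simp
  ultimately show ?thesis by (simp add: cF cF0 nat_add_distrib nat_mult_distrib)
qed

end

section \<open>Vertices and edges of an odd cycle\<close>

locale odd_cycle =
  fixes xs :: "'a list" and n :: nat
  assumes n_pos: "n \<ge> 1" and distinct_xs: "distinct xs" and length_xs: "length xs = 2 * n + 1"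
begin

text \<open>Indexing by all integers makes the edge from the last vertex back to the first no
  special case.\<close>

definition vertex :: "int \<Rightarrow> 'a" where
  "vertex i = xs ! nat (i mod (2 * int n + 1))"

definition edge :: "int \<Rightarrow> 'a set" where
  "edge i = {vertex i, vertex (i + 1)}"

lemma vertex_eq_iff: "vertex i = vertex j \<longleftrightarrow> (2 * int n + 1) dvd (i - j)"
proof -
  have lt: "nat (k mod (2 * int n + 1)) < length xs" for k
    using pos_mod_bound[of "2 * int n + 1" k] pos_mod_sign[of "2 * int n + 1" k] length_xs
    by linarith
  have "vertex i = vertex j \<longleftrightarrow> nat (i mod (2 * int n + 1)) = nat (j mod (2 * int n + 1))"
    unfolding vertex_def using distinct_xs lt by (simp add: nth_eq_iff_index_eq)
  also have "\<dots> \<longleftrightarrow> i mod (2 * int n + 1) = j mod (2 * int n + 1)"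
    by (simp add: eq_nat_nat_iff)
  finally show ?thesis by (simp add: mod_eq_dvd_iff)
qed

lemma range_vertex: "range vertex = set xs"
proof
  show "range vertex \<subseteq> set xs"
  proof
    fix v assume "v \<in> range vertex"
    then obtain i where "v = vertex i" by blast
    moreover have "nat (i mod (2 * int n + 1)) < length xs"
      using pos_mod_bound[of "2 * int n + 1" i] pos_mod_sign[of "2 * int n + 1" i] length_xs
      by linarith
    ultimately show "v \<in> set xs" by (simp add: vertex_def)
  qed
  show "set xs \<subseteq> range vertex"
  proof
    fix v assume "v \<in> set xs"
    then obtain k where "k < length xs" "v = xs ! k" by (auto simp: in_set_conv_nth)
    then have "v = vertex (int k)" using length_xs by (simp add: vertex_def)
    then show "v \<in> range vertex" by blast
  qed
qed

lemma edge_eq_nth: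
  "edge i = {xs ! nat (i mod (2 * int n + 1)),
             xs ! (Suc (nat (i mod (2 * int n + 1))) mod length xs)}"
proof -
  let ?k = "nat (i mod (2 * int n + 1))"
  have "int (Suc ?k mod length xs) = (i + 1) mod (2 * int n + 1)"
    by (simp add: length_xs zmod_int mod_simps add.commute)
  then have "nat ((i + 1) mod (2 * int n + 1)) = Suc ?k mod length xs" by (metis nat_int)
  then show ?thesis by (simp add: edge_def vertex_def)
qed

lemma edges_cycle: "edges (cycle_graph xs) = range edge"
proof
  show "edges (cycle_graph xs) \<subseteq> range edge"
  proof
    fix e assume "e \<in> edges (cycle_graph xs)"
    then obtain k where k: "k < length xs" "e = {xs ! k, xs ! (Suc k mod length xs)}"
      by (auto simp: cycle_graph_def)
    then have "e = edge (int k)" by (simp add: edge_eq_nth length_xs)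
    then show "e \<in> range edge" by blast
  qed
  show "range edge \<subseteq> edges (cycle_graph xs)"
  proof
    fix e assume "e \<in> range edge"
    then obtain i where i: "e = edge i" by blast
    moreover have "nat (i mod (2 * int n + 1)) < length xs"
      using pos_mod_bound[of "2 * int n + 1" i] pos_mod_sign[of "2 * int n + 1" i] length_xs
      by linarith
    ultimately show "e \<in> edges (cycle_graph xs)"
      unfolding cycle_graph_def using edge_eq_nth[of i] by auto
  qed
qed

text \<open>Two edges with ends matched crosswise would force \<open>2n + 1\<close> to divide 2,
  impossible for \<open>n \<ge> 1\<close>.\<close>

lemma edge_eq_iff: "edge i = edge j \<longleftrightarrow> (2 * int n + 1) dvd (i - j)"
proof
  let ?N = "2 * int n + 1"
  assume "edge i = edge j"
  then have "vertex i = vertex j \<or> (vertex i = vertex (j + 1) \<and> vertex (i + 1) = vertex j)"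
    by (auto simp: edge_def doubleton_eq_iff)
  moreover have False if "?N dvd i - (j + 1)" "?N dvd (i + 1) - j"
  proof -
    have "?N dvd 2" using dvd_diff[OF that(2,1)] by simp
    then show False using zdvd_imp_le[of ?N 2] n_pos by simp
  qed
  ultimately show "?N dvd i - j" by (auto simp: vertex_eq_iff)
next
  assume "(2 * int n + 1) dvd (i - j)"
  then have "vertex i = vertex j" "vertex (i + 1) = vertex (j + 1)"
    by (simp_all add: vertex_eq_iff)
  then show "edge i = edge j" by (simp add: edge_def)
qed

lemma vertex_in_edge_iff: "vertex p \<in> edge i \<longleftrightarrow> edge i = edge p \<or> edge i = edge (p - 1)"
proof -
  have "(2 * int n + 1) dvd (p - i) \<longleftrightarrow> (2 * int n + 1) dvd (i - p)"
    "(2 * int n + 1) dvd (p - (i + 1)) \<longleftrightarrow> (2 * int n + 1) dvd (i - (p - 1))"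
    by (metis dvd_minus_iff minus_diff_eq,
        metis dvd_minus_iff minus_diff_eq diff_diff_eq2 add.commute)
  moreover have "vertex p \<in> edge i \<longleftrightarrow> vertex p = vertex i \<or> vertex p = vertex (i + 1)"
    by (simp add: edge_def)
  ultimately show ?thesis by (simp only: vertex_eq_iff edge_eq_iff)
qed

text \<open>As 2 is invertible modulo \<open>2n + 1\<close>, steps of two meet every edge; adjacent
  edges get indices at distance \<open>n\<close>.\<close>

definition step2_edge :: "int \<Rightarrow> 'a set" where
  "step2_edge i = edge (2 * i)"

text \<open>\<open>n + 1\<close> is the inverse of 2 modulo \<open>2n + 1\<close>:
  \<open>2p (n + 1) = p + p (2n + 1)\<close>.\<close>

lemma edge_eq_step2_edge: "edge p = step2_edge (p * (int n + 1))"
  unfolding step2_edge_def edge_eq_iff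
  by (rule dvdI[of _ _ "- p"]) (simp add: algebra_simps)

lemma range_step2_edge: "range step2_edge = range edge"
  using edge_eq_step2_edge by (auto simp: step2_edge_def)

sublocale step2: odd_cyclic_enumeration step2_edge n
proof
  fix i j
  have "coprime (2 * int n + 1) 2" by simp
  then have "(2 * int n + 1) dvd 2 * (i - j) \<longleftrightarrow> (2 * int n + 1) dvd (i - j)"
    by (rule coprime_dvd_mult_right_iff)
  then show "step2_edge i = step2_edge j \<longleftrightarrow> (2 * int n + 1) dvd (i - j)"
    unfolding step2_edge_def edge_eq_iff right_diff_distrib .
qed (rule n_pos)

section \<open>Type-I edge covers as gap-free sets\<close>

lemma type1_edge_cover_iff_gap_free:
  assumes "induced_subgraph (cycle_graph xs) G"
  shows "type1_edge_cover (cycle_graph xs) G L \<longleftrightarrow> step2.gap_free L"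
proof -
  have "edges (cycle_graph xs) \<subseteq> edges G" using assms by (auto simp: induced_subgraph_def)
  moreover have "verts (cycle_graph xs) = range vertex"
    by (simp add: cycle_graph_def range_vertex)
  ultimately have "type1_edge_cover (cycle_graph xs) G L \<longleftrightarrow>
      L \<subseteq> range edge \<and> (\<forall>p. \<exists>e\<in>L. vertex p \<in> e)"
    unfolding type1_edge_cover_def edge_cover_def edges_cycle by auto
  also have "\<dots> \<longleftrightarrow> L \<subseteq> range edge \<and> (\<forall>p. edge p \<in> L \<or> edge (p - 1) \<in> L)"
  proof (rule conj_cong[OF refl], rule all_cong1)
    fix p assume L: "L \<subseteq> range edge"
    show "(\<exists>e\<in>L. vertex p \<in> e) \<longleftrightarrow> edge p \<in> L \<or> edge (p - 1) \<in> L"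
    proof
      assume "\<exists>e\<in>L. vertex p \<in> e"
      then obtain i where "edge i \<in> L" "vertex p \<in> edge i" using L by blast
      then show "edge p \<in> L \<or> edge (p - 1) \<in> L" using vertex_in_edge_iff[of p i] by auto
    next
      assume "edge p \<in> L \<or> edge (p - 1) \<in> L"
      then show "\<exists>e\<in>L. vertex p \<in> e"
        using vertex_in_edge_iff[of p p] vertex_in_edge_iff[of p "p - 1"] by blast
    qed
  qed
  also have "(\<forall>p. edge p \<in> L \<or> edge (p - 1) \<in> L) \<longleftrightarrow>
      (\<forall>p. step2_edge p \<in> L \<or> step2_edge (p + int n) \<in> L)"
  proof -
    \<comment> \<open>\<open>2 (q + n)\<close> exceeds \<open>2q - 1\<close> by exactly one
      period.\<close>
    have pred: "step2_edge (q + int n) = edge (2 * q - 1)" for q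
      unfolding step2_edge_def edge_eq_iff by (simp add: algebra_simps)
    have "edge (p - 1) = step2_edge (p * (int n + 1) + int n)" for p
      unfolding pred edge_eq_iff by (rule dvdI[of _ _ "- p"]) (simp add: algebra_simps)
    \<comment> \<open>The pairs translate in both directions, \<open>p\<close> to
      \<open>p (n + 1)\<close> and \<open>q\<close> to \<open>2q\<close>.\<close>
    then have "edge p = step2_edge (p * (int n + 1))
        \<and> edge (p - 1) = step2_edge (p * (int n + 1) + int n)" for p
      by (intro conjI edge_eq_step2_edge)
    moreover have "step2_edge q = edge (2 * q) \<and> step2_edge (q + int n) = edge (2 * q - 1)" for q
      by (intro conjI pred) (rule step2_edge_def)
    ultimately show ?thesis by metis
  qed
  finally show ?thesis by (simp add: step2.gap_free_def range_step2_edge)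
qed

text \<open>Intervals attain the bound \<open>n + 1\<close>, so the minimum covers are the gap-free
  sets of that size. Intervals are among them, and each of them contains one.\<close>

lemma contains_type1_min_edge_cover_iff:
  assumes "induced_subgraph (cycle_graph xs) G"
  shows "(\<exists>L\<subseteq>S. type1_min_edge_cover (cycle_graph xs) G L) \<longleftrightarrow>
    (\<exists>i. step2_edge ` {i..i + int n} \<subseteq> S)"
proof -
  have c: "card (step2_edge ` {i..i + int n}) = n + 1" for i
    by (simp add: step2.card_interval nat_add_distrib)
  have "type1_min_edge_cover (cycle_graph xs) G L \<longleftrightarrow> step2.gap_free L \<and> card L = n + 1" for L
    unfolding type1_min_edge_cover_def type1_edge_cover_iff_gap_free[OF assms]
    using step2.card_gap_free_ge step2.gap_free_interval c by (metis le_antisym)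
  then show ?thesis
    using c step2.gap_free_interval step2.gap_free_min_contains_interval
    by (metis order_trans)
qed

end

section \<open>The three ranges of cardinalities\<close>

theorem lemma3p6:
  fixes G C :: "'a graph" and xs :: "'a list" and n l :: nat
  assumes "finite_simple_graph G"
    and "n \<ge> 1"
    and "distinct xs" and "length xs = 2 * n + 1"
    and "C = cycle_graph xs"
    and "induced_subgraph C G"
    and "l = card (edges G - edges C)"
  shows "card (edges G) = 2 * n + 1 + l
    \<and> (\<forall>k \<le> n - 1. num_containing_type1_min C G (n + 1 + k)
          = (2 * n + 1) * ((n - 1 + l) choose k))
    \<and> (\<forall>k < l. num_containing_type1_min C G (2 * n + 1 + k)
          = (2 * n + 1) * ((n - 1 + l) choose (n + k)) + (l choose k))
    \<and> num_containing_type1_min C G (2 * n + 1 + l) = 1"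
proof -
  interpret odd_cycle xs n using assms by unfold_locales
  have eC: "edges C = range step2_edge"
    using assms(5) edges_cycle range_step2_edge by simp
  have fin: "finite (edges G)"
    using assms(1) by (auto simp: finite_simple_graph_def intro: finite_subset[of _ "Pow (verts G)"])
  have sub: "edges C \<subseteq> edges G" using assms(6) by (auto simp: induced_subgraph_def)
  have card: "card (edges G) = 2 * n + 1 + l"
    using fin sub assms(7) step2.card_range unfolding eC
    by (metis card_Diff_subset card_mono finite_subset le_add_diff_inverse)
  have num: "num_containing_type1_min C G (n + 1 + m)
      = (2 * n + 1) * ((n - 1 + l) choose m) + (if n \<le> m then l choose (m - n) else 0)" for m
    unfolding num_containing_type1_min_def assms(5)
      contains_type1_min_edge_cover_iff[OF assms(6)[unfolded assms(5)]]
    by (rule step2.card_sets_containing_interval[OF fin sub[unfolded eC] assms(7)[unfolded eC]])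
  \<comment> \<open>Here \<open>2n + 1 + k\<close> is read as \<open>n + 1 + m\<close> with
    \<open>m = n + k\<close>, so the second summand is present.\<close>
  have large: "num_containing_type1_min C G (2 * n + 1 + k)
      = (2 * n + 1) * ((n - 1 + l) choose (n + k)) + (l choose k)" for k
    using num[of "n + k"] by (simp add: mult_2 add.assoc add.left_commute)
  show ?thesis
  proof (intro conjI allI impI)
    \<comment> \<open>\<open>k \<le> n - 1\<close> with \<open>n \<ge> 1\<close> gives
      \<open>k < n\<close>, so the second summand vanishes.\<close>
    show "num_containing_type1_min C G (n + 1 + k) = (2 * n + 1) * ((n - 1 + l) choose k)"
      if "k \<le> n - 1" for k
      using num[of k] that assms(2) by simp
    \<comment> \<open>At \<open>k = l\<close> the first binomial has \<open>n + l\<close> over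
      \<open>n - 1 + l\<close> and is 0, while \<open>l choose l\<close> is 1.\<close>
    show "num_containing_type1_min C G (2 * n + 1 + l) = 1"
      using large[of l] assms(2) by simp
  qed (use card large in auto)
qed

end
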